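(* Let $\mathcal T$ be a tetrahedral mesh with $N_v$ vertices $\mathbf x_i=(x_i,y_i,z_i)\in\mathbb R^3$, $0\le i\le N_v-1$, and $N_c$ positively oriented tetrahedra $\tau_0,\dots,\tau_{N_c-1}$. Let $\mu_n=\frac{R_n}{3r_n}$ be the radius ratio of $\tau_n$, where $R_n$ is its circumradius and $r_n$ its inradius, and regard the energy function $$F=\frac1{N_c}\sum_{n=0}^{N_c-1}\mu_n$$ as a function of the vertex coordinates $\mathbf V=[\mathbf X^T,\mathbf Y^T,\mathbf Z^T]^T$, where $\mathbf X=[x_0,\dots,x_{N_v-1}]^T$, $\mathbf Y=[y_0,\dots,y_{N_v-1}]^T$, $\mathbf Z=[z_0,\dots,z_{N_v-1}]^T$. Then $$\nabla_{\mathbf V}F=\begin{bmatrix} \mathbf A & \mathbf B_2 & \mathbf B_1 \\ -\mathbf B_2 & \mathbf A & \mathbf B_0 \\ -\mathbf B_1 & -\mathbf B_0 & \mathbf A \end{bmatrix}\begin{bmatrix} \mathbf X \\ \mathbf Y \\ \mathbf Z \end{bmatrix}=\mathbf G_F\mathbf V,$$ where $\mathbf A$ is an $N_v\times N_v$ symmetric matrix and $\mathbf B_0,\mathbf B_1,\mathbf B_2$ are $N_v\times N_v$ antisymmetric matrices. Here $\mathbf A,\mathbf B_0,\mathbf B_1,\mathbf B_2$ (which depend on $\mathbf V$) are assembled over all elements from the element gradient matrices given in the context.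
   Context: A tetrahedron with ordered vertices $(\mathbf x_0,\mathbf x_1,\mathbf x_2,\mathbf x_3)$ is positively oriented if $\det[\mathbf x_1-\mathbf x_0,\ \mathbf x_2-\mathbf x_0,\ \mathbf x_3-\mathbf x_0]>0$. Element matrices. Let $\tau_n$ have (local, ordered) vertices $\mathbf x_i=(x_i,y_i,z_i)$, $i=0,1,2,3$, and volume $|\tau_n|$; let $s_i$ be the area of the face opposite to $\mathbf x_i$, and $s=s_0+s_1+s_2+s_3$. Write $\mathbf v_{ij}=\mathbf x_j-\mathbf x_i$ and $\mathbf v^2=\mathbf v\cdot\mathbf v$. Let $$\mathbf d=\mathbf v_{30}^2\,\mathbf v_{10}\times\mathbf v_{20}+\mathbf v_{10}^2\,\mathbf v_{20}\times\mathbf v_{30}+\mathbf v_{20}^2\,\mathbf v_{30}\times\mathbf v_{10}=(d_0,d_1,d_2),$$ so that $R_n=\frac{|\mathbf d|}{12|\tau_n|}$, $r_n=\frac{3|\tau_n|}{s}$, $\mu_n=\frac{s|\mathbf d|}{108|\tau_n|^2}$. Put $c_{23}=\mathbf d\cdot(\mathbf v_{20}\times\mathbf v_{30})$, $c_{31}=\mathbf d\cdot(\mathbf v_{30}\times\mathbf v_{10})$, $c_{12}=\mathbf d\cdot(\mathbf v_{10}\times\mathbf v_{20})$, $c=c_{23}+c_{31}+c_{12}$, and $k_{23}=\mathbf v_{30}^2-\mathbf v_{20}^2$, $k_{31}=\mathbf v_{10}^2-\mathbf v_{30}^2$, $k_{12}=\mathbf v_{20}^2-\mathbf v_{10}^2$.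 Define $$\mathbf L=\begin{bmatrix} 2c & -2c_{23} & -2c_{31} & -2c_{12} \\ -2c_{23} & 2c_{23} & 0 & 0 \\ -2c_{31} & 0 & 2c_{31} & 0 \\ -2c_{12} & 0 & 0 & 2c_{12} \end{bmatrix},\qquad \mathbf K=\begin{bmatrix} 0 & -k_{23} & -k_{31} & -k_{12} \\ k_{23} & 0 & -\mathbf v_{30}^2 & \mathbf v_{20}^2 \\ k_{31} & \mathbf v_{30}^2 & 0 & -\mathbf v_{10}^2 \\ k_{12} & -\mathbf v_{20}^2 & \mathbf v_{10}^2 & 0 \end{bmatrix}.$$ Let $$\mathbf S=\begin{bmatrix} p_0 & q_{01} & q_{02} & q_{03} \\ q_{01} & p_1 & q_{12} & q_{13} \\ q_{02} & q_{12} & p_2 & q_{23} \\ q_{03} & q_{13} & q_{23} & p_3 \end{bmatrix}$$ with $$p_0=\tfrac{\mathbf v_{31}^2}{4s_2}+\tfrac{\mathbf v_{21}^2}{4s_3}+\tfrac{\mathbf v_{32}^2}{4s_1},\quad p_1=\tfrac{\mathbf v_{32}^2}{4s_0}+\tfrac{\mathbf v_{02}^2}{4s_3}+\tfrac{\mathbf v_{30}^2}{4s_2},$$ $$p_2=\tfrac{\mathbf v_{30}^2}{4s_1}+\tfrac{\mathbf v_{10}^2}{4s_3}+\tfrac{\mathbf v_{31}^2}{4s_0},\quad p_3=\tfrac{\mathbf v_{10}^2}{4s_2}+\tfrac{\mathbf v_{20}^2}{4s_1}+\tfrac{\mathbf v_{21}^2}{4s_0},$$ $$q_{01}=-\Big(\tfrac{\mathbf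 v_{31}\cdot\mathbf v_{30}}{4s_2}+\tfrac{\mathbf v_{21}\cdot\mathbf v_{20}}{4s_3}\Big),\quad q_{02}=-\Big(\tfrac{\mathbf v_{32}\cdot\mathbf v_{30}}{4s_1}+\tfrac{\mathbf v_{12}\cdot\mathbf v_{10}}{4s_3}\Big),\quad q_{03}=-\Big(\tfrac{\mathbf v_{23}\cdot\mathbf v_{20}}{4s_1}+\tfrac{\mathbf v_{13}\cdot\mathbf v_{10}}{4s_2}\Big),$$ $$q_{12}=-\Big(\tfrac{\mathbf v_{32}\cdot\mathbf v_{31}}{4s_0}+\tfrac{\mathbf v_{02}\cdot\mathbf v_{01}}{4s_3}\Big),\quad q_{13}=-\Big(\tfrac{\mathbf v_{03}\cdot\mathbf v_{01}}{4s_2}+\tfrac{\mathbf v_{23}\cdot\mathbf v_{21}}{4s_0}\Big),\quad q_{23}=-\Big(\tfrac{\mathbf v_{13}\cdot\mathbf v_{12}}{4s_0}+\tfrac{\mathbf v_{03}\cdot\mathbf v_{02}}{4s_1}\Big).$$ For scalars $w_0,w_1,w_2,w_3$ set $$\mathbf C(w)=\begin{bmatrix} 0 & w_2 & w_3 & w_1 \\ w_3 & 0 & w_0 & w_2 \\ w_1 & w_3 & 0 & w_0 \\ w_2 & w_0 & w_1 & 0 \end{bmatrix},$$ and let $\mathbf C_0=\mathbf C(x)$, $\mathbf C_1=\mathbf C(y)$, $\mathbf C_2=\mathbf C(z)$ be formed from the $x$-, $y$- and $z$-coordinates of the four vertices. Define $$\mathbf A_n=\frac{1}{12|\tau_n|R_n}\mathbf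 L+\frac1s\mathbf S,\qquad \mathbf B_{0n}=\frac{-d_0}{12|\tau_n|R_n}\mathbf K-\frac1{6|\tau_n|}(\mathbf C_0^T-\mathbf C_0),$$ $$\mathbf B_{1n}=\frac{d_1}{12|\tau_n|R_n}\mathbf K-\frac1{6|\tau_n|}(\mathbf C_1^T-\mathbf C_1),\qquad \mathbf B_{2n}=\frac{-d_2}{12|\tau_n|R_n}\mathbf K-\frac1{6|\tau_n|}(\mathbf C_2^T-\mathbf C_2).$$ The element gradient matrix, which multiplies $\mathbf V_n=[x_0,x_1,x_2,x_3,y_0,y_1,y_2,y_3,z_0,z_1,z_2,z_3]^T$ to give $\nabla_{\mathbf V_n}\mu_n$, is $$\mu_n\begin{bmatrix} \mathbf A_n & \mathbf B_{2n} & \mathbf B_{1n} \\ -\mathbf B_{2n} & \mathbf A_n & \mathbf B_{0n} \\ -\mathbf B_{1n} & -\mathbf B_{0n} & \mathbf A_n \end{bmatrix}.$$ Assembly. If the local vertices $0,1,2,3$ of $\tau_n$ have global indices $g_n(0),\dots,g_n(3)$, then $$\mathbf A_{ij}=\frac1{N_c}\sum_{n=0}^{N_c-1}\ \sum_{\substack{0\le a,b\le 3 \\ g_n(a)=i,\ g_n(b)=j}}\mu_n(\mathbf A_n)_{ab},$$ and $\mathbf B_0,\mathbf B_1,\mathbf B_2$ are obtained in the same way from the $\mathbf B_{0n},\mathbf B_{1n},\mathbf B_{2n}$.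
   Formalization: The element matrices are corrected: the coefficient 1/(12|τ_n|R_n) of L and K is replaced by 1/(12|τ_n|R_n)^2 in A_n, B_0n, B_1n, B_2n, and the term (1/(6|τ_n|))(C_1^T − C_1) in B_1n has sign + instead of −; as printed the gradient formula is false. *)

theory Defs
  imports "HOL-Analysis.Analysis"
begin

unbundle cross3_syntax

section \<open>A single tetrahedron\<close>

text \<open>
  A tetrahedron is given by its ordered vertices \<open>p :: 4 \<Rightarrow> real^3\<close>; the local indices 0, 1, 2, 3
  are the four elements of the type \<open>4\<close>. The coordinates of a point \<open>w :: real^3\<close> are
  \<open>w $ 1\<close>, \<open>w $ 2\<close>, \<open>w $ 3\<close>.
\<close>

type_synonym tet = "4 \<Rightarrow> real^3"

definition edge :: "tet \<Rightarrow> 4 \<Rightarrow> 4 \<Rightarrow> real^3" where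
  "edge p i j = p j - p i"

definition edge2 :: "tet \<Rightarrow> 4 \<Rightarrow> 4 \<Rightarrow> real" where
  "edge2 p i j = edge p i j \<bullet> edge p i j"

definition positively_oriented :: "tet \<Rightarrow> bool" where
  "positively_oriented p \<longleftrightarrow>
     det (transpose (vector [p 1 - p 0, p 2 - p 0, p 3 - p 0]) :: real^3^3) > 0"

definition tet_volume :: "tet \<Rightarrow> real" where
  "tet_volume p = measure lebesgue (convex hull (range p))"

definition triangle_area :: "real^3 \<Rightarrow> real^3 \<Rightarrow> real^3 \<Rightarrow> real" where
  "triangle_area a b c = norm ((b - a) \<times> (c - a)) / 2"

definition face_area :: "tet \<Rightarrow> 4 \<Rightarrow> real" where
  "face_area p i =
     (if i = 0 then triangle_area (p 1) (p 2) (p 3)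
      else if i = 1 then triangle_area (p 0) (p 2) (p 3)
      else if i = 2 then triangle_area (p 0) (p 1) (p 3)
      else triangle_area (p 0) (p 1) (p 2))"

definition surface_area :: "tet \<Rightarrow> real" where
  "surface_area p = (\<Sum>i\<in>UNIV. face_area p i)"

text \<open>
  Circumscribed sphere: it passes through the four vertices. Inscribed sphere: it bounds a ball
  contained in the tetrahedron and touches each of the four faces. Both radii are uniquely
  determined if the tetrahedron is nondegenerate.
\<close>

definition circumradius :: "tet \<Rightarrow> real" where
  "circumradius p = (THE R. \<exists>c. range p \<subseteq> sphere c R)"

definition inradius :: "tet \<Rightarrow> real" where
  "inradius p = (THE r. \<exists>c. cball c r \<subseteq> convex hull (range p) \<and>
                   (\<forall>i. sphere c r \<inter> convex hull (p ` (UNIV - {i})) \<noteq> {}))"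

definition radius_ratio :: "tet \<Rightarrow> real" where
  "radius_ratio p = circumradius p / (3 * inradius p)"


section \<open>Element matrices\<close>

text \<open>
  Row lists with indices starting at 0. The library function \<open>vector\<close> counts from 1, so in type
  \<open>4\<close> it would put its last entry at index \<open>4 = 0\<close>.
\<close>

definition vec4 :: "'a \<Rightarrow> 'a \<Rightarrow> 'a \<Rightarrow> 'a \<Rightarrow> 'a^4" where
  "vec4 a0 a1 a2 a3 = (\<chi> i. if i = 0 then a0 else if i = 1 then a1 else if i = 2 then a2 else a3)"

definition dvec :: "tet \<Rightarrow> real^3" where
  "dvec p = edge2 p 3 0 *\<^sub>R (edge p 1 0 \<times> edge p 2 0)
          + edge2 p 1 0 *\<^sub>R (edge p 2 0 \<times> edge p 3 0)
          + edge2 p 2 0 *\<^sub>R (edge p 3 0 \<times> edge p 1 0)"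

definition Lmat :: "tet \<Rightarrow> real^4^4" where
  "Lmat p =
    (let c23 = dvec p \<bullet> (edge p 2 0 \<times> edge p 3 0);
         c31 = dvec p \<bullet> (edge p 3 0 \<times> edge p 1 0);
         c12 = dvec p \<bullet> (edge p 1 0 \<times> edge p 2 0);
         c = c23 + c31 + c12
     in vec4
         (vec4 (2 * c) (- 2 * c23) (- 2 * c31) (- 2 * c12))
         (vec4 (- 2 * c23) (2 * c23) 0 0)
         (vec4 (- 2 * c31) 0 (2 * c31) 0)
         (vec4 (- 2 * c12) 0 0 (2 * c12)))"

definition Kmat :: "tet \<Rightarrow> real^4^4" where
  "Kmat p =
    (let k23 = edge2 p 3 0 - edge2 p 2 0;
         k31 = edge2 p 1 0 - edge2 p 3 0;
         k12 = edge2 p 2 0 - edge2 p 1 0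
     in vec4
         (vec4 0 (- k23) (- k31) (- k12))
         (vec4 k23 0 (- edge2 p 3 0) (edge2 p 2 0))
         (vec4 k31 (edge2 p 3 0) 0 (- edge2 p 1 0))
         (vec4 k12 (- edge2 p 2 0) (edge2 p 1 0) 0))"

definition Smat :: "tet \<Rightarrow> real^4^4" where
  "Smat p =
    (let s0 = face_area p 0; s1 = face_area p 1; s2 = face_area p 2; s3 = face_area p 3;
         p0 = edge2 p 3 1 / (4 * s2) + edge2 p 2 1 / (4 * s3) + edge2 p 3 2 / (4 * s1);
         p1 = edge2 p 3 2 / (4 * s0) + edge2 p 0 2 / (4 * s3) + edge2 p 3 0 / (4 * s2);
         p2 = edge2 p 3 0 / (4 * s1) + edge2 p 1 0 / (4 * s3) + edge2 p 3 1 / (4 * s0);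
         p3 = edge2 p 1 0 / (4 * s2) + edge2 p 2 0 / (4 * s1) + edge2 p 2 1 / (4 * s0);
         q01 = - ((edge p 3 1 \<bullet> edge p 3 0) / (4 * s2) + (edge p 2 1 \<bullet> edge p 2 0) / (4 * s3));
         q02 = - ((edge p 3 2 \<bullet> edge p 3 0) / (4 * s1) + (edge p 1 2 \<bullet> edge p 1 0) / (4 * s3));
         q03 = - ((edge p 2 3 \<bullet> edge p 2 0) / (4 * s1) + (edge p 1 3 \<bullet> edge p 1 0) / (4 * s2));
         q12 = - ((edge p 3 2 \<bullet> edge p 3 1) / (4 * s0) + (edge p 0 2 \<bullet> edge p 0 1) / (4 * s3));
         q13 = - ((edge p 0 3 \<bullet> edge p 0 1) / (4 * s2) + (edge p 2 3 \<bullet> edge p 2 1) / (4 * s0));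
         q23 = - ((edge p 1 3 \<bullet> edge p 1 2) / (4 * s0) + (edge p 0 3 \<bullet> edge p 0 2) / (4 * s1))
     in vec4
         (vec4 p0 q01 q02 q03)
         (vec4 q01 p1 q12 q13)
         (vec4 q02 q12 p2 q23)
         (vec4 q03 q13 q23 p3))"

definition Cmat :: "tet \<Rightarrow> 3 \<Rightarrow> real^4^4" where
  "Cmat p k =
    (let w0 = p 0 $ k; w1 = p 1 $ k; w2 = p 2 $ k; w3 = p 3 $ k
     in vec4
         (vec4 0 w2 w3 w1)
         (vec4 w3 0 w0 w2)
         (vec4 w1 w3 0 w0)
         (vec4 w2 w0 w1 0))"

text \<open>
  Since \<open>12 * tet_volume p * circumradius p = norm (dvec p)\<close>, the logarithmic derivative of
  \<open>norm (dvec p)\<close> carries the factor \<open>1 / (12 * tet_volume p * circumradius p)^2\<close>; the first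
  power found in the literature is dimensionally inconsistent. The matrices
  \<open>B0mat\<close>, \<open>B1mat\<close>, \<open>B2mat\<close> enter the gradient like the components \<open>- a_x\<close>, \<open>a_y\<close>, \<open>- a_z\<close>
  of a cross product, so that both summands of \<open>B1mat\<close> have the sign opposite to that in
  \<open>B0mat\<close> and \<open>B2mat\<close>.
\<close>

definition Amat :: "tet \<Rightarrow> real^4^4" where
  "Amat p = (1 / (12 * tet_volume p * circumradius p)^2) *\<^sub>R Lmat p
          + (1 / surface_area p) *\<^sub>R Smat p"

definition B0mat :: "tet \<Rightarrow> real^4^4" where
  "B0mat p = (- (dvec p $ 1) / (12 * tet_volume p * circumradius p)^2) *\<^sub>R Kmat p
           - (1 / (6 * tet_volume p)) *\<^sub>R (transpose (Cmat p 1) - Cmat p 1)"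

definition B1mat :: "tet \<Rightarrow> real^4^4" where
  "B1mat p = (dvec p $ 2 / (12 * tet_volume p * circumradius p)^2) *\<^sub>R Kmat p
           + (1 / (6 * tet_volume p)) *\<^sub>R (transpose (Cmat p 2) - Cmat p 2)"

definition B2mat :: "tet \<Rightarrow> real^4^4" where
  "B2mat p = (- (dvec p $ 3) / (12 * tet_volume p * circumradius p)^2) *\<^sub>R Kmat p
           - (1 / (6 * tet_volume p)) *\<^sub>R (transpose (Cmat p 3) - Cmat p 3)"


section \<open>Meshes\<close>

text \<open>
  Vertices are indexed by a finite type \<open>'v\<close> and cells by a finite type \<open>'c\<close>, so that
  \<open>N_v = CARD('v)\<close> and \<open>N_c = CARD('c)\<close>. The connectivity \<open>g n a\<close> is the global index of the
  local vertex \<open>a\<close> of the cell \<open>n\<close>. The coordinate vector \<open>V = [X, Y, Z]\<close> is indexed by three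
  consecutive copies of \<open>'v\<close>.
\<close>

definition stack :: "'a^'v \<Rightarrow> 'a^'v \<Rightarrow> 'a^'v \<Rightarrow> 'a^('v + 'v + 'v)" where
  "stack X Y Z = (\<chi> k. case k of Inl i \<Rightarrow> X $ i | Inr (Inl i) \<Rightarrow> Y $ i | Inr (Inr i) \<Rightarrow> Z $ i)"

definition block_matrix ::
  "'a^'v^'v \<Rightarrow> 'a^'v^'v \<Rightarrow> 'a^'v^'v \<Rightarrow>
   'a^'v^'v \<Rightarrow> 'a^'v^'v \<Rightarrow> 'a^'v^'v \<Rightarrow>
   'a^'v^'v \<Rightarrow> 'a^'v^'v \<Rightarrow> 'a^'v^'v \<Rightarrow> 'a^('v + 'v + 'v)^('v + 'v + 'v)" where
  "block_matrix M11 M12 M13 M21 M22 M23 M31 M32 M33 =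
     stack (\<chi> i. stack (M11 $ i) (M12 $ i) (M13 $ i))
           (\<chi> i. stack (M21 $ i) (M22 $ i) (M23 $ i))
           (\<chi> i. stack (M31 $ i) (M32 $ i) (M33 $ i))"

definition mesh_vertex :: "real^('v::finite + 'v + 'v) \<Rightarrow> 'v \<Rightarrow> real^3" where
  "mesh_vertex V i = vector [V $ Inl i, V $ Inr (Inl i), V $ Inr (Inr i)]"

definition cell :: "('c \<Rightarrow> 4 \<Rightarrow> 'v) \<Rightarrow> real^('v::finite + 'v + 'v) \<Rightarrow> 'c \<Rightarrow> tet" where
  "cell g V n = (\<lambda>a. mesh_vertex V (g n a))"

definition mesh_energy :: "('c::finite \<Rightarrow> 4 \<Rightarrow> 'v) \<Rightarrow> real^('v::finite + 'v + 'v) \<Rightarrow> real" where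
  "mesh_energy g V = 1 / real CARD('c) * (\<Sum>n\<in>UNIV. radius_ratio (cell g V n))"

definition assemble ::
  "(tet \<Rightarrow> real^4^4) \<Rightarrow> ('c::finite \<Rightarrow> 4 \<Rightarrow> 'v) \<Rightarrow> real^('v::finite + 'v + 'v) \<Rightarrow> real^'v^'v" where
  "assemble M g V = (\<chi> i j. 1 / real CARD('c) *
     (\<Sum>n\<in>UNIV. \<Sum>(a, b)\<in>{(a, b). g n a = i \<and> g n b = j}.
        radius_ratio (cell g V n) * M (cell g V n) $ a $ b))"

end

(* With D six times the signed volume of a tetrahedron, s its surface area and d the vector dvec,
   the inradius is D / (2 s) and the circumradius is |d| / (2 D), so that the radius ratio is
   s |d| / (3 D^2) on the open set of positively oriented tetrahedra. For the inradius, an inscribed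
   ball of radius r has barycentric coordinates r |N_i| / D at its centre, where N_i is the inward
   normal of the face i of length twice its area; these coordinates add up to 1. For the
   circumradius, d . (x_i - x_0) = D |x_i - x_0|^2, so the circumcentre is x_0 + d / (2 D).
   The logarithmic derivative of the radius ratio is s'/s + d . d' / |d|^2 - 2 D'/D. In a direction q,
   the first term is given by S, the second by L (through inner products p_b . q_a) and K (through
   triple products d . (p_b x q_a)), and the third by the antisymmetric parts of the matrices C.
   The global gradient is the sum of these element gradients. *)
theory Submission
  imports Defs
begin

section \<open>Indexing by 0, 1, 2, 3\<close>

text \<open>The library enumerates this type as 1, 2, 3, 4, where \<open>4 = 0\<close>; the local
  vertices are numbered from 0.\<close>

lemma UNIV_4_0: "(UNIV::4 set) = {0,1,2,3}"
  using exhaust_4 by force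

lemma sum_4_0: "sum f (UNIV::4 set) = f 0 + f 1 + f 2 + f 3"
  for f :: "4 \<Rightarrow> 'b::ab_group_add"
  unfolding UNIV_4_0 by (simp add: add.assoc)

lemma forall_4_0: "(\<forall>i::4. P i) \<longleftrightarrow> P 0 \<and> P 1 \<and> P 2 \<and> P 3"
  by (metis UNIV_4_0 UNIV_I empty_iff insert_iff)

lemma vec4_nth [simp]:
  "vec4 a0 a1 a2 a3 $ 0 = a0" "vec4 a0 a1 a2 a3 $ 1 = a1"
  "vec4 a0 a1 a2 a3 $ 2 = a2" "vec4 a0 a1 a2 a3 $ 3 = a3"
  by (simp_all add: vec4_def)

subsection \<open>Volume, inradius and circumradius\<close>

text \<open>Six times the signed volume.\<close>

definition tet_det :: "tet \<Rightarrow> real" where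
  "tet_det p = (p 1 - p 0) \<bullet> ((p 2 - p 0) \<times> (p 3 - p 0))"

section \<open>Barycentric coordinates and faces\<close>

text \<open>Besides being normal to face \<open>i\<close>, this vector is the gradient of
  \<open>tet_det\<close> with respect to vertex \<open>i\<close>.\<close>

definition inward_normal :: "tet \<Rightarrow> 4 \<Rightarrow> real^3" where
  "inward_normal p i =
     (if i = 0 then (p 3 - p 1) \<times> (p 2 - p 1)
      else if i = 1 then (p 2 - p 0) \<times> (p 3 - p 0)
      else if i = 2 then (p 3 - p 0) \<times> (p 1 - p 0)
      else (p 1 - p 0) \<times> (p 2 - p 0))"

text \<open>Barycentric coordinate of \<open>x\<close> at vertex \<open>i\<close>. All four are
  expanded at \<open>p 0\<close>, where coordinate 0 is 1 and the others vanish.\<close>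

definition bary :: "tet \<Rightarrow> 4 \<Rightarrow> real^3 \<Rightarrow> real" where
  "bary p i x = (if i = 0 then 1 else 0) + inward_normal p i \<bullet> (x - p 0) / tet_det p"

lemma positively_oriented_iff: "positively_oriented p \<longleftrightarrow> tet_det p > 0"
  unfolding positively_oriented_def tet_det_def dot_cross_det det_transpose ..

lemma norm_inward_normal: "norm (inward_normal p i) = 2 * face_area p i"
  unfolding inward_normal_def face_area_def triangle_area_def
  by auto (metis cross_skew norm_minus_cancel)+

text \<open>The area vectors of a closed polyhedral surface cancel; hence the barycentric
  coordinates have a constant sum.\<close>

lemma sum_inward_normal: "(\<Sum>i\<in>UNIV. inward_normal p i) = 0"
  by (simp add: sum_4_0 inward_normal_def Cross3.left_diff_distrib Cross3.right_diff_distrib)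
   (simp add: cross3_simps)

lemma bary_add: "bary p i (x + v) = bary p i x + inward_normal p i \<bullet> v / tet_det p"
  by (simp add: bary_def inner_diff_right inner_add_right diff_divide_distrib add_divide_distrib)

lemma sum_bary: "(\<Sum>i\<in>UNIV. bary p i x) = 1"
proof -
  have "(\<Sum>i\<in>UNIV. bary p i x) = 1 + (\<Sum>i\<in>UNIV. inward_normal p i) \<bullet> (x - p 0) / tet_det p"
    by (simp add: bary_def sum_4_0 inner_add_left add_divide_distrib)
  then show ?thesis by (simp add: sum_inward_normal)
qed

text \<open>Cramer's rule in the basis \<open>a\<close>, \<open>b\<close>, \<open>c\<close>, cleared
  of the denominator.\<close>

lemma triple_expansion:
  fixes x a b c :: "real^3"
  shows "(a \<bullet> (b \<times> c)) *\<^sub>R x = ((b \<times> c) \<bullet> x) *\<^sub>R a + ((c \<times> a) \<bullet> x) *\<^sub>R b + ((a \<times> b) \<bullet> x) *\<^sub>R c"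
  by (simp add: cross3_simps forall_3)

text \<open>Expansion in the reciprocal basis. A vector orthogonal to three independent vectors is
  therefore zero, which makes the circumcentre unique.\<close>

lemma triple_expansion_dual:
  fixes x a b c :: "real^3"
  shows "(a \<bullet> (b \<times> c)) *\<^sub>R x = (a \<bullet> x) *\<^sub>R (b \<times> c) + (b \<bullet> x) *\<^sub>R (c \<times> a) + (c \<bullet> x) *\<^sub>R (a \<times> b)"
  by (simp add: cross3_simps forall_3)

lemma bary_vertex:
  assumes "tet_det p \<noteq> 0"
  shows "bary p i (p j) = (if i = j then 1 else 0)"
proof -
  \<comment> \<open>A normal is orthogonal to the edges of its face. The base point
    \<open>p 0\<close> lies off face 0 only, so \<open>i = 0\<close> has its own case.\<close>
  have "\<forall>i j. inward_normal p i \<bullet> (p j - p 0) =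
      (if j = 0 then 0 else if i = j then tet_det p else if i = 0 then - tet_det p else 0)"
    unfolding forall_4_0 inward_normal_def tet_det_def
    by (simp add: Cross3.left_diff_distrib Cross3.right_diff_distrib) (simp add: cross3_simps)
  then show ?thesis
    using assms by (simp add: bary_def)
qed

lemma bary_expansion:
  assumes "tet_det p \<noteq> 0"
  shows "(\<Sum>i\<in>UNIV. bary p i x *\<^sub>R p i) = x"
proof -
  let ?b = "\<lambda>i. bary p i x"
  have "(\<Sum>i\<in>UNIV. ?b i *\<^sub>R p i) =
      (\<Sum>i\<in>UNIV. ?b i) *\<^sub>R p 0 + ?b 1 *\<^sub>R (p 1 - p 0) + ?b 2 *\<^sub>R (p 2 - p 0) + ?b 3 *\<^sub>R (p 3 - p 0)"
    by (simp add: sum_4_0 algebra_simps)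
  also have "\<dots> = p 0 + (1 / tet_det p) *\<^sub>R (tet_det p *\<^sub>R (x - p 0))"
    unfolding sum_bary unfolding tet_det_def triple_expansion
    by (simp add: bary_def inward_normal_def tet_det_def scaleR_add_right)
  finally show ?thesis using assms by simp
qed

lemma bary_face:
  assumes "tet_det p \<noteq> 0" "x \<in> convex hull (p ` (UNIV - {i}))"
  shows "bary p i x = 0"
proof -
  \<comment> \<open>The zero set of coordinate \<open>i\<close>, cleared of the denominator to be
    visibly a hyperplane.\<close>
  let ?H = "{x. inward_normal p i \<bullet> x = inward_normal p i \<bullet> p 0 - (if i = 0 then tet_det p else 0)}"
  have eq: "x \<in> ?H \<longleftrightarrow> bary p i x = 0" for x
    using assms(1) by (auto simp: bary_def field_simps inner_diff_right)
  have "p ` (UNIV - {i}) \<subseteq> ?H"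
    using assms(1) by (auto simp: eq[simplified] bary_vertex)
  then have "convex hull (p ` (UNIV - {i})) \<subseteq> ?H"
    by (intro hull_minimal convex_hyperplane)
  then show ?thesis using assms(2) eq by blast
qed

text \<open>Each coordinate is nonnegative at the vertices, so its half-space contains the hull;
  conversely, nonnegative coordinates are the weights of a convex combination.\<close>

lemma convex_hull_tet:
  assumes "tet_det p > 0"
  shows "convex hull (range p) = {x. \<forall>i. 0 \<le> bary p i x}"
proof
  let ?H = "\<lambda>i. {x. inward_normal p i \<bullet> x \<ge> inward_normal p i \<bullet> p 0 - (if i = 0 then tet_det p else 0)}"
  have eq: "x \<in> ?H i \<longleftrightarrow> 0 \<le> bary p i x" for x i
    using assms by (auto simp: bary_def field_simps inner_diff_right)
  have "range p \<subseteq> (\<Inter>i. ?H i)"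
    using assms by (auto simp: eq[simplified] bary_vertex)
  then have "convex hull (range p) \<subseteq> (\<Inter>i. ?H i)"
    by (intro hull_minimal convex_INT convex_halfspace_ge)
  then show "convex hull (range p) \<subseteq> {x. \<forall>i. 0 \<le> bary p i x}"
    using eq by blast
  show "{x. \<forall>i. 0 \<le> bary p i x} \<subseteq> convex hull (range p)"
  proof clarify
    fix x assume "\<forall>i. 0 \<le> bary p i x"
    then have "(\<Sum>i\<in>UNIV. bary p i x *\<^sub>R p i) \<in> convex hull (range p)"
      by (intro convex_sum sum_bary) (auto intro: hull_inc)
    then show "x \<in> convex hull (range p)"
      using assms by (simp add: bary_expansion)
  qed
qed

text \<open>The weight of \<open>p i\<close> vanishes, so the other three still add up to 1 and
  express \<open>x\<close>.\<close>

lemma mem_face_if_bary: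
  assumes "tet_det p > 0" "\<And>j. 0 \<le> bary p j x" "bary p i x = 0"
  shows "x \<in> convex hull (p ` (UNIV - {i}))"
proof -
  have "(\<Sum>j\<in>UNIV - {i}. bary p j x *\<^sub>R p j) \<in> convex hull (p ` (UNIV - {i}))"
    using assms(2,3) sum_bary[of p x]
    by (intro convex_sum) (auto intro: hull_inc simp: sum_diff1)
  moreover have "(\<Sum>j\<in>UNIV - {i}. bary p j x *\<^sub>R p j) = x"
    using assms(1,3) bary_expansion[of p x] by (simp add: sum_diff1)
  ultimately show ?thesis by simp
qed

text \<open>A zero normal would make coordinate \<open>i\<close> constant, but it is 1 at
  \<open>p i\<close> and 0 at the other vertices.\<close>

lemma face_area_pos:
  assumes "tet_det p > 0"
  shows "face_area p i > 0"
proof -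
  have "inward_normal p i \<noteq> 0"
  proof
    assume "inward_normal p i = 0"
    then have "bary p i (p i) = bary p i (p (if i = 0 then 1 else 0))"
      by (simp add: bary_def)
    then show False
      using assms by (auto simp: bary_vertex split: if_splits)
  qed
  then show ?thesis
    using norm_inward_normal[of p i] by (metis mult_zero_right norm_ge_zero norm_eq_zero
        zero_less_mult_pos less_eq_real_def zero_less_numeral)
qed

lemma surface_area_pos:
  assumes "tet_det p > 0"
  shows "surface_area p > 0"
  using assms by (auto simp: surface_area_def intro!: sum_pos face_area_pos)

section \<open>The inscribed ball\<close>

lemma inradius_eq:
  assumes D: "tet_det p > 0"
  shows "inradius p = tet_det p / (2 * surface_area p)"
proof -
  let ?r = "tet_det p / (2 * surface_area p)"
  let ?N = "inward_normal p"
  have s: "surface_area p > 0" by (rule surface_area_pos[OF D])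
  have N0: "?N i \<noteq> 0" for i
    using face_area_pos[OF D, of i] norm_inward_normal[of p i] by auto
  have dir: "?N i \<bullet> (t *\<^sub>R sgn (?N i)) = t * norm (?N i)" for i t
    using N0[of i] by (simp add: sgn_div_norm dot_square_norm power2_eq_square)
  have "inradius p = ?r"
    unfolding inradius_def
  proof (rule the_equality)
    \<comment> \<open>The incentre: its barycentric coordinates are proportional to the opposite
      face areas.\<close>
    let ?c = "\<Sum>i\<in>UNIV. (face_area p i / surface_area p) *\<^sub>R p i"
    have c: "bary p i ?c = face_area p i / surface_area p" for i
    proof -
      have sum1: "(\<Sum>j\<in>UNIV. face_area p j / surface_area p) = 1"
        using s by (simp add: surface_area_def flip: sum_divide_distrib)
      have lin: "bary p i (\<Sum>j\<in>UNIV. a j *\<^sub>R p j) = (\<Sum>j\<in>UNIV. a j * bary p i (p j))"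
        if "(\<Sum>j\<in>UNIV. a j) = 1" for a
      proof -
        have "(\<Sum>j\<in>UNIV. a j *\<^sub>R p j) - p 0 = (\<Sum>j\<in>UNIV. a j *\<^sub>R (p j - p 0))"
          by (simp add: scaleR_diff_right sum_subtractf that flip: scaleR_left.sum)
        then show ?thesis
          by (simp add: bary_def inner_sum_right sum_divide_distrib distrib_left sum.distrib that
              flip: sum_distrib_right)
      qed
      show ?thesis
        using D by (simp add: lin[OF sum1] bary_vertex if_distrib cong: if_cong)
    qed
    have ball: "cball ?c ?r \<subseteq> convex hull (range p)"
    proof
      fix x assume "x \<in> cball ?c ?r"
      then have n: "norm (x - ?c) \<le> ?r" by (simp add: dist_norm norm_minus_commute)
      have "0 \<le> bary p i x" for i
      proof -
        \<comment> \<open>A displacement of length at most \<open>?r\<close> changes coordinate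
          \<open>i\<close> by at most its value at the centre.\<close>
        have "\<bar>?N i \<bullet> (x - ?c)\<bar> \<le> norm (?N i) * ?r"
          using Cauchy_Schwarz_ineq2[of "?N i" "x - ?c"] n
          by (meson mult_left_mono norm_ge_zero order_trans)
        also have "\<dots> = face_area p i / surface_area p * tet_det p"
          by (simp add: norm_inward_normal)
        finally have "- (face_area p i / surface_area p) \<le> ?N i \<bullet> (x - ?c) / tet_det p"
          using D by (simp add: field_simps)
        then show ?thesis
          using bary_add[of p i ?c "x - ?c"] by (simp add: c)
      qed
      then show "x \<in> convex hull (range p)"
        using convex_hull_tet[OF D] by blast
    qed
    have "sphere ?c ?r \<inter> convex hull (p ` (UNIV - {i})) \<noteq> {}" for i
    proof -
      \<comment> \<open>The foot of the perpendicular from the centre to face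
        \<open>i\<close>.\<close>
      let ?q = "?c + (- ?r) *\<^sub>R sgn (?N i)"
      have q: "?q \<in> sphere ?c ?r"
        using N0[of i] s D by (simp add: dist_norm norm_sgn)
      then have "?q \<in> convex hull (range p)"
        using ball sphere_cball by blast
      then have "\<And>j. 0 \<le> bary p j ?q"
        using convex_hull_tet[OF D] by blast
      moreover have "bary p i ?q = 0"
        unfolding bary_add c dir using D s by (simp add: norm_inward_normal field_simps)
      ultimately show ?thesis
        using mem_face_if_bary[OF D] q by blast
    qed
    then show "\<exists>c. cball c ?r \<subseteq> convex hull (range p) \<and>
                (\<forall>i. sphere c ?r \<inter> convex hull (p ` (UNIV - {i})) \<noteq> {})"
      using ball by blast
  next
    fix r
    assume "\<exists>c. cball c r \<subseteq> convex hull (range p) \<and>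
                (\<forall>i. sphere c r \<inter> convex hull (p ` (UNIV - {i})) \<noteq> {})"
    then obtain c where c: "cball c r \<subseteq> convex hull (range p)"
      "\<And>i. sphere c r \<inter> convex hull (p ` (UNIV - {i})) \<noteq> {}" by blast
    \<comment> \<open>The touching point bounds coordinate \<open>i\<close> from above; the point of
      the ball farthest towards face \<open>i\<close> bounds it from below.\<close>
    have "bary p i c = r * norm (?N i) / tet_det p" for i
    proof (rule antisym)
      obtain q where q: "dist c q = r" "q \<in> convex hull (p ` (UNIV - {i}))"
        using c(2)[of i] unfolding sphere_def by blast
      have "0 = bary p i c + ?N i \<bullet> (q - c) / tet_det p"
        using bary_face[OF _ q(2)] bary_add[of p i c "q - c"] D by simp
      moreover have "- (?N i \<bullet> (q - c)) \<le> r * norm (?N i)"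
        using Cauchy_Schwarz_ineq2[of "?N i" "q - c"] q(1)
        by (simp add: dist_norm norm_minus_commute mult.commute)
      ultimately show "bary p i c \<le> r * norm (?N i) / tet_det p"
        using D by (simp add: field_simps)
      \<comment> \<open>For negative \<open>r\<close> the ball would be empty; the touching point
        excludes this.\<close>
      have "r \<ge> 0" using q(1) by auto
      then have "c + (- r) *\<^sub>R sgn (?N i) \<in> cball c r"
        using N0[of i] by (simp add: dist_norm norm_sgn)
      then have "0 \<le> bary p i (c + (- r) *\<^sub>R sgn (?N i))"
        using c(1) convex_hull_tet[OF D] by blast
      then show "r * norm (?N i) / tet_det p \<le> bary p i c"
        unfolding bary_add dir by simp
    qed
    then have "(\<Sum>i\<in>UNIV. r * (2 * face_area p i) / tet_det p) = 1"
      using sum_bary[of p c] by (simp add: norm_inward_normal)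
    then have "2 * r * surface_area p = tet_det p"
      using D by (simp add: surface_area_def sum_distrib_left mult.assoc mult.left_commute
          flip: sum_divide_distrib)
    then show "r = ?r" using s by (simp add: field_simps)
  qed
  then show ?thesis .
qed

section \<open>The volume as a determinant\<close>

lemma inj_tet:
  assumes "tet_det p \<noteq> 0"
  shows "inj p"
  by (rule injI) (metis assms bary_vertex zero_neq_one)

lemma tet_volume_eq:
  assumes D: "tet_det p > 0"
  shows "tet_volume p = tet_det p / 6"
proof -
  let ?f = "\<lambda>j::3. if j = 1 then p 1 else if j = 2 then p 2 else p 3"
  have inj: "inj p" using D by (intro inj_tet) simp
  have r: "range p = {p 0, p 1, p 2, p 3}" by (auto simp: UNIV_4_0)
  have ne: "p i = p j \<longleftrightarrow> i = j" for i j using inj by (simp add: inj_eq)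
  have "measure lborel (convex hull (range p)) =
      \<bar>det (\<chi> i. \<chi> j. ?f j $ i - p 0 $ i)\<bar> / fact (CARD(3))"
  proof (rule content_simplex)
    show "card (range p) = Suc CARD(3)"
      using card_image[OF inj] by simp
    have f: "?f ` UNIV = {p 1, p 2, p 3}" unfolding UNIV_3 by auto
    show "bij_betw ?f UNIV (range p - {p 0})"
      unfolding bij_betw_def
    proof
      have "\<forall>i j. ?f i = ?f j \<longrightarrow> i = j"
        unfolding forall_3 by (simp add: ne)
      then show "inj ?f" unfolding inj_def .
      show "range ?f = range p - {p 0}"
        unfolding f r using ne by auto
    qed
  qed auto
  also have "det (\<chi> i. \<chi> j. ?f j $ i - p 0 $ i) = tet_det p"
    by (simp add: tet_det_def cross3_simps)
  finally have "measure lborel (convex hull (range p)) = tet_det p / 6"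
    using D by (simp add: fact_numeral)
  \<comment> \<open>The hull is compact, hence Borel, so its \<open>lebesgue\<close> and
    \<open>lborel\<close> measures agree.\<close>
  moreover have "compact (convex hull (range p))"
    by (intro finite_imp_compact_convex_hull) simp
  ultimately show ?thesis
    by (simp add: tet_volume_def measure_completion borel_compact)
qed

section \<open>The circumscribed sphere\<close>

text \<open>The defining edges point towards \<open>p 0\<close>. Reversing both factors of an inner
  or cross product leaves it unchanged.\<close>

lemma dvec_eq:
  "dvec p = ((p 1 - p 0) \<bullet> (p 1 - p 0)) *\<^sub>R ((p 2 - p 0) \<times> (p 3 - p 0))
          + ((p 2 - p 0) \<bullet> (p 2 - p 0)) *\<^sub>R ((p 3 - p 0) \<times> (p 1 - p 0))
          + ((p 3 - p 0) \<bullet> (p 3 - p 0)) *\<^sub>R ((p 1 - p 0) \<times> (p 2 - p 0))"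
proof -
  have "edge p i 0 = - (p i - p 0)" for i by (simp add: edge_def)
  then show ?thesis by (simp only: dvec_def edge2_def cross_minus_left cross_minus_right
        inner_minus_left inner_minus_right minus_minus add_ac)
qed

text \<open>\<open>dvec p\<close> is written in the reciprocal basis of the edges at
  \<open>p 0\<close>, so pairing with one edge keeps a single term.\<close>

lemma dvec_inner: "dvec p \<bullet> (p i - p 0) = tet_det p * ((p i - p 0) \<bullet> (p i - p 0))"
proof -
  have cyc: "a \<bullet> (b \<times> c) = b \<bullet> (c \<times> a)" "a \<bullet> (b \<times> c) = c \<bullet> (a \<times> b)" for a b c :: "real^3"
    by (simp_all add: cross3_simps)
  have "\<forall>i. dvec p \<bullet> (p i - p 0) = tet_det p * ((p i - p 0) \<bullet> (p i - p 0))"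
    unfolding forall_4_0 dvec_eq tet_det_def
    by (simp add: inner_add_left dot_cross_self inner_commute[of "_ \<times> _"] cyc[symmetric])
  then show ?thesis ..
qed

lemma dvec_nonzero:
  assumes "tet_det p \<noteq> 0"
  shows "dvec p \<noteq> 0"
proof
  assume "dvec p = 0"
  then have "p 1 = p 0"
    using dvec_inner[of p 1] assms by simp
  then show False using inj_tet[OF assms] by (simp add: inj_eq)
qed

text \<open>The perpendicular bisector of the segment from 0 to \<open>u\<close>: equidistance
  becomes a linear condition on \<open>v\<close>.\<close>

lemma norm_diff_eq_norm_iff:
  fixes v u :: "'a::real_inner"
  shows "norm (v - u) = norm v \<longleftrightarrow> 2 * (v \<bullet> u) = u \<bullet> u"
proof -
  have "norm (v - u) = norm v \<longleftrightarrow> (v - u) \<bullet> (v - u) = v \<bullet> v"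
    by (simp add: norm_eq)
  also have "(v - u) \<bullet> (v - u) = v \<bullet> v - 2 * (v \<bullet> u) + u \<bullet> u"
    by (simp add: inner_diff inner_commute)
  finally show ?thesis by auto
qed

lemma circumradius_eq:
  assumes D: "tet_det p > 0"
  shows "circumradius p = norm (dvec p) / (2 * tet_det p)"
  unfolding circumradius_def
proof (rule the_equality)
  let ?v = "(1 / (2 * tet_det p)) *\<^sub>R dvec p"
  have "dist (p 0 + ?v) (p i) = norm ?v" for i
  proof -
    have "2 * (?v \<bullet> (p i - p 0)) = (p i - p 0) \<bullet> (p i - p 0)"
      unfolding inner_scaleR_left dvec_inner using D by simp
    then have "norm (?v - (p i - p 0)) = norm ?v"
      unfolding norm_diff_eq_norm_iff .
    then show ?thesis
      by (simp add: dist_norm algebra_simps)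
  qed
  then have "range p \<subseteq> sphere (p 0 + ?v) (norm (dvec p) / (2 * tet_det p))"
    using D by auto
  then show "\<exists>c. range p \<subseteq> sphere c (norm (dvec p) / (2 * tet_det p))" ..
next
  fix R assume "\<exists>c. range p \<subseteq> sphere c R"
  then obtain c where c: "\<And>i. dist c (p i) = R" unfolding sphere_def by blast
  \<comment> \<open>The offset between \<open>c\<close> and the claimed circumcentre, times
    \<open>2 * tet_det p\<close>. It is orthogonal to all edges at \<open>p 0\<close>, hence
    zero.\<close>
  define x where "x = (2 * tet_det p) *\<^sub>R (c - p 0) - dvec p"
  have "(p i - p 0) \<bullet> x = 0" for i
  proof -
    have "norm ((c - p 0) - (p i - p 0)) = norm (c - p 0)"
      using c[of i] c[of 0] by (simp add: dist_norm)
    then have "2 * ((c - p 0) \<bullet> (p i - p 0)) = (p i - p 0) \<bullet> (p i - p 0)"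
      unfolding norm_diff_eq_norm_iff .
    then have "x \<bullet> (p i - p 0) = 0"
      unfolding x_def inner_diff_left[of "_ *\<^sub>R _"] inner_scaleR_left dvec_inner by simp
    then show ?thesis by (simp add: inner_commute)
  qed
  then have "tet_det p *\<^sub>R x = 0"
    unfolding tet_det_def triple_expansion_dual by simp
  then have "dvec p = (2 * tet_det p) *\<^sub>R (c - p 0)"
    using D by (simp add: x_def)
  moreover have "norm (c - p 0) = R" using c[of 0] by (simp add: dist_norm)
  ultimately show "R = norm (dvec p) / (2 * tet_det p)" using D by simp
qed

lemma radius_ratio_eq:
  assumes "positively_oriented p"
  shows "radius_ratio p = surface_area p * norm (dvec p) / (3 * (tet_det p)\<^sup>2)"
  using assms
  by (simp add: positively_oriented_iff radius_ratio_def circumradius_eq inradius_eq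
      power2_eq_square mult_ac)

subsection \<open>The element gradient\<close>

lemma bounded_bilinear_cross: "bounded_bilinear (\<times>)"
  using bilinear_cross bilinear_conv_bounded_bilinear by blast

lemmas has_derivative_cross [derivative_intros] =
  bounded_bilinear.FDERIV[OF bounded_bilinear_cross]

lemma has_derivative_norm_compose:
  fixes f :: "'a::real_normed_vector \<Rightarrow> 'b::real_inner"
  assumes "(f has_derivative f') (at x)" "f x \<noteq> 0"
  shows "((\<lambda>x. norm (f x)) has_derivative (\<lambda>h. (f x \<bullet> f' h) / norm (f x))) (at x)"
  using has_derivative_compose[OF assms(1) has_derivative_norm[OF assms(2)]]
  by (simp add: sgn_div_norm inner_commute divide_inverse mult.commute)

text \<open>The Binet-Cauchy identity; it removes cross products from the derivative of an
  area.\<close>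

lemma cross_inner_cross: "(a \<times> b) \<bullet> (c \<times> d) = (a \<bullet> c) * (b \<bullet> d) - (a \<bullet> d) * (b \<bullet> c)"
  for a b c d :: "real^3"
  by (simp add: cross3_simps)

text \<open>Sorted by inner products of a vertex with a displacement, so that the coefficients are
  the contributions of one face to \<open>Smat\<close>.\<close>

lemma triangle_area_has_derivative:
  fixes a b c :: "'a::real_normed_vector \<Rightarrow> real^3"
  assumes [derivative_intros]: "(a has_derivative a') (at x)" "(b has_derivative b') (at x)"
      "(c has_derivative c') (at x)"
    and nz: "triangle_area (a x) (b x) (c x) \<noteq> 0"
  shows "((\<lambda>x. triangle_area (a x) (b x) (c x)) has_derivative (\<lambda>h.
      (((c x - b x) \<bullet> (c x - b x)) * (a x \<bullet> a' h) + ((c x - a x) \<bullet> (c x - a x)) * (b x \<bullet> b' h)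
       + ((b x - a x) \<bullet> (b x - a x)) * (c x \<bullet> c' h)
       - ((a x - c x) \<bullet> (b x - c x)) * (a x \<bullet> b' h + b x \<bullet> a' h)
       - ((a x - b x) \<bullet> (c x - b x)) * (a x \<bullet> c' h + c x \<bullet> a' h)
       - ((b x - a x) \<bullet> (c x - a x)) * (b x \<bullet> c' h + c x \<bullet> b' h))
      / (4 * triangle_area (a x) (b x) (c x)))) (at x)"
    (is "(_ has_derivative (\<lambda>h. ?e (a x) (b x) (c x) (a' h) (b' h) (c' h) / _)) _")
proof -
  let ?n = "\<lambda>x. (b x - a x) \<times> (c x - a x)"
  let ?n' = "\<lambda>a b c a' b' c'. (b - a) \<times> (c' - a') + (b' - a') \<times> (c - a)"
  have id: "((b - a) \<times> (c - a)) \<bullet> ?n' a b c a' b' c' = ?e a b c a' b' c'"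
    for a b c a' b' c' :: "real^3"
    unfolding inner_add_right cross_inner_cross
    by (simp add: inner_diff inner_commute algebra_simps)
  have "(?n has_derivative (\<lambda>h. ?n' (a x) (b x) (c x) (a' h) (b' h) (c' h))) (at x)"
    by (auto intro!: derivative_eq_intros)
  then have "((\<lambda>x. norm (?n x)) has_derivative
      (\<lambda>h. ?n x \<bullet> ?n' (a x) (b x) (c x) (a' h) (b' h) (c' h) / norm (?n x))) (at x)"
    using nz by (intro has_derivative_norm_compose) (auto simp: triangle_area_def)
  from has_derivative_mult_right[OF this, of "1/2"] show ?thesis
    unfolding id triangle_area_def by simp
qed

section \<open>Derivatives along a differentiable family of tetrahedra\<close>

context
  fixes P :: "'a::real_normed_vector \<Rightarrow> tet" and P' :: "'a \<Rightarrow> tet" and x :: 'a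
  assumes P [derivative_intros]: "\<And>a. ((\<lambda>x. P x a) has_derivative (\<lambda>h. P' h a)) (at x)"
begin

text \<open>The determinant is affine in each vertex, with the normal of the opposite face as
  gradient.\<close>

lemma tet_det_has_derivative:
  "((\<lambda>x. tet_det (P x)) has_derivative (\<lambda>h. \<Sum>i\<in>UNIV. inward_normal (P x) i \<bullet> P' h i)) (at x)"
proof -
  have id: "u1 \<bullet> (u2 \<times> (r3 - r0) + (r2 - r0) \<times> u3) + (r1 - r0) \<bullet> (u2 \<times> u3)
      = - (u2 \<times> u3 + u3 \<times> u1 + u1 \<times> u2) \<bullet> r0 + (u2 \<times> u3) \<bullet> r1 + (u3 \<times> u1) \<bullet> r2 + (u1 \<times> u2) \<bullet> r3"
    for u1 u2 u3 r0 r1 r2 r3 :: "real^3"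
    by (simp add: cross3_simps)
  have N0: "inward_normal p 0 = - ((p 2 - p 0) \<times> (p 3 - p 0) + (p 3 - p 0) \<times> (p 1 - p 0)
      + (p 1 - p 0) \<times> (p 2 - p 0))" for p
    by (simp add: inward_normal_def cross3_simps)
  have N: "inward_normal p 1 = (p 2 - p 0) \<times> (p 3 - p 0)"
    "inward_normal p 2 = (p 3 - p 0) \<times> (p 1 - p 0)"
    "inward_normal p 3 = (p 1 - p 0) \<times> (p 2 - p 0)" for p
    by (simp_all add: inward_normal_def)
  show ?thesis
    unfolding tet_det_def
    by (rule derivative_eq_intros P refl)+
      (simp only: id sum_4_0 N0 N)
qed

lemma dvec_has_derivative:
  defines "u \<equiv> \<lambda>i. P x i - P x 0" and "w \<equiv> \<lambda>h i. P' h i - P' h 0"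
  shows "((\<lambda>x. dvec (P x)) has_derivative (\<lambda>h.
      (2 * (u 1 \<bullet> w h 1)) *\<^sub>R (u 2 \<times> u 3) + (u 1 \<bullet> u 1) *\<^sub>R (u 2 \<times> w h 3 + w h 2 \<times> u 3)
    + (2 * (u 2 \<bullet> w h 2)) *\<^sub>R (u 3 \<times> u 1) + (u 2 \<bullet> u 2) *\<^sub>R (u 3 \<times> w h 1 + w h 3 \<times> u 1)
    + (2 * (u 3 \<bullet> w h 3)) *\<^sub>R (u 1 \<times> u 2) + (u 3 \<bullet> u 3) *\<^sub>R (u 1 \<times> w h 2 + w h 1 \<times> u 2))) (at x)"
  unfolding dvec_eq
  by (rule derivative_eq_intros P refl)+
    (simp only: u_def w_def inner_commute[of "P' _ _ - P' _ _"] mult_2 add_ac)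

text \<open>Face \<open>i\<close> contributes to the rows and columns of \<open>Smat\<close> other
  than \<open>i\<close>.\<close>

lemma surface_area_has_derivative:
  assumes "tet_det (P x) > 0"
  shows "((\<lambda>x. surface_area (P x)) has_derivative
      (\<lambda>h. \<Sum>a\<in>UNIV. \<Sum>b\<in>UNIV. Smat (P x) $ a $ b * (P x b \<bullet> P' h a))) (at x)"
proof -
  note pos = face_area_pos[OF assms]
  have nz: "triangle_area (P x 1) (P x 2) (P x 3) \<noteq> 0" "triangle_area (P x 0) (P x 2) (P x 3) \<noteq> 0"
    "triangle_area (P x 0) (P x 1) (P x 3) \<noteq> 0" "triangle_area (P x 0) (P x 1) (P x 2) \<noteq> 0"
    using pos[of 0] pos[of 1] pos[of 2] pos[of 3] by (auto simp: face_area_def)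
  have face: "face_area p 0 = triangle_area (p 1) (p 2) (p 3)"
    "face_area p 1 = triangle_area (p 0) (p 2) (p 3)"
    "face_area p 2 = triangle_area (p 0) (p 1) (p 3)"
    "face_area p 3 = triangle_area (p 0) (p 1) (p 2)" for p
    by (simp_all add: face_area_def)
  show ?thesis
    unfolding surface_area_def sum_4_0[of "face_area _"] face
    by (rule has_derivative_eq_rhs, (rule has_derivative_add triangle_area_has_derivative P nz)+, rule ext)
      (simp add: sum_4_0 Smat_def Let_def vec4_def edge2_def edge_def face
          add_divide_distrib diff_divide_distrib inner_commute algebra_simps)
qed

end

section \<open>The logarithmic derivative in terms of the element matrices\<close>

text \<open>Differentiating the squared edge lengths in \<open>dvec\<close> produces
  \<open>Lmat\<close>; differentiating the cross products produces \<open>Kmat\<close>.\<close>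

lemma dvec_inner_derivative:
  defines "u \<equiv> \<lambda>p i. p i - p 0 :: real^3"
  shows "dvec p \<bullet>
    ((2 * (u p 1 \<bullet> u q 1)) *\<^sub>R (u p 2 \<times> u p 3) + (u p 1 \<bullet> u p 1) *\<^sub>R (u p 2 \<times> u q 3 + u q 2 \<times> u p 3)
    + (2 * (u p 2 \<bullet> u q 2)) *\<^sub>R (u p 3 \<times> u p 1) + (u p 2 \<bullet> u p 2) *\<^sub>R (u p 3 \<times> u q 1 + u q 3 \<times> u p 1)
    + (2 * (u p 3 \<bullet> u q 3)) *\<^sub>R (u p 1 \<times> u p 2) + (u p 3 \<bullet> u p 3) *\<^sub>R (u p 1 \<times> u q 2 + u q 1 \<times> u p 2))
    = (\<Sum>a\<in>UNIV. \<Sum>b\<in>UNIV. Lmat p $ a $ b * (p b \<bullet> q a))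
    + (\<Sum>a\<in>UNIV. \<Sum>b\<in>UNIV. Kmat p $ a $ b * (dvec p \<bullet> (p b \<times> q a)))"
proof -
  define d where "d = dvec p"
  define E where "E i = u p i \<bullet> u p i" for i
  define c where "c i j = d \<bullet> (u p i \<times> u p j)" for i j
  have e: "edge p i 0 = - u p i" for i by (simp add: edge_def u_def)
  have e2: "edge2 p i 0 = E i" for i by (simp add: edge2_def e E_def)
  have L: "(\<Sum>a\<in>UNIV. \<Sum>b\<in>UNIV. Lmat p $ a $ b * (p b \<bullet> q a))
      = 2 * (u p 1 \<bullet> u q 1) * c 2 3 + 2 * (u p 2 \<bullet> u q 2) * c 3 1 + 2 * (u p 3 \<bullet> u q 3) * c 1 2"
    unfolding Lmat_def e cross_minus_left cross_minus_right minus_minus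
      d_def[symmetric] c_def[symmetric] Let_def
    by (simp add: sum_4_0 vec4_def u_def inner_diff algebra_simps)
  have swap: "d \<bullet> (q i \<times> p j) = - (d \<bullet> (p j \<times> q i))" for i j
    by (subst cross_skew) simp
  have K: "(\<Sum>a\<in>UNIV. \<Sum>b\<in>UNIV. Kmat p $ a $ b * (d \<bullet> (p b \<times> q a)))
      = E 1 * (d \<bullet> (u p 2 \<times> u q 3 + u q 2 \<times> u p 3)) + E 2 * (d \<bullet> (u p 3 \<times> u q 1 + u q 3 \<times> u p 1))
      + E 3 * (d \<bullet> (u p 1 \<times> u q 2 + u q 1 \<times> u p 2))"
    unfolding Kmat_def e2 Let_def
    by (simp add: sum_4_0 vec4_def u_def Cross3.left_diff_distrib Cross3.right_diff_distrib
        inner_diff inner_add_right swap algebra_simps)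
  show ?thesis
    unfolding d_def[symmetric] L K
    by (simp add: inner_add_right E_def c_def algebra_simps)
qed

text \<open>Both sides are quadratic in the vertices of \<open>p\<close>. The factor -2 is the
  exponent of \<open>tet_det\<close> in the radius ratio.\<close>

lemma Cmat_cross_sum:
  "(\<Sum>a\<in>UNIV. \<Sum>b\<in>UNIV. \<Sum>k\<in>UNIV. (transpose (Cmat p k) - Cmat p k) $ a $ b * (p b \<times> q a) $ k)
    = - 2 * (\<Sum>i\<in>UNIV. inward_normal p i \<bullet> q i)"
  by (simp add: sum_4_0 sum_3 transpose_def Cmat_def Let_def inward_normal_def
      cross3_def inner_vec_def vector_def algebra_simps)

text \<open>The displacement \<open>q\<close> paired with the element gradient at \<open>p\<close>,
  without the factor \<open>radius_ratio p\<close>. The six off-diagonal blocks are paired into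
  components of \<open>p b \<times> q a\<close>.\<close>

definition element_form :: "tet \<Rightarrow> tet \<Rightarrow> real" where
  "element_form p q = (\<Sum>a\<in>UNIV. \<Sum>b\<in>UNIV.
      Amat p $ a $ b * (p b \<bullet> q a) - B0mat p $ a $ b * (p b \<times> q a) $ 1
      + B1mat p $ a $ b * (p b \<times> q a) $ 2 - B2mat p $ a $ b * (p b \<times> q a) $ 3)"

lemma element_form_eq:
  assumes D: "tet_det p > 0"
  shows "element_form p q =
      (\<Sum>a\<in>UNIV. \<Sum>b\<in>UNIV. Smat p $ a $ b * (p b \<bullet> q a)) / surface_area p
    + ((\<Sum>a\<in>UNIV. \<Sum>b\<in>UNIV. Lmat p $ a $ b * (p b \<bullet> q a))
       + (\<Sum>a\<in>UNIV. \<Sum>b\<in>UNIV. Kmat p $ a $ b * (dvec p \<bullet> (p b \<times> q a)))) / (norm (dvec p))\<^sup>2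
    - 2 * (\<Sum>i\<in>UNIV. inward_normal p i \<bullet> q i) / tet_det p"
proof -
  \<comment> \<open>These identities turn the prefactors of the matrices into powers of
    \<open>norm (dvec p)\<close> and \<open>tet_det p\<close>.\<close>
  have VR: "12 * tet_volume p * circumradius p = norm (dvec p)" and V: "6 * tet_volume p = tet_det p"
    using D by (simp_all add: tet_volume_eq circumradius_eq)
  define C where "C k = transpose (Cmat p k) - Cmat p k" for k
  have "element_form p q = (\<Sum>a\<in>UNIV. \<Sum>b\<in>UNIV.
      Smat p $ a $ b * (p b \<bullet> q a) / surface_area p
      + (Lmat p $ a $ b * (p b \<bullet> q a) / (norm (dvec p))\<^sup>2
         + Kmat p $ a $ b * (dvec p \<bullet> (p b \<times> q a)) / (norm (dvec p))\<^sup>2)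
      + (\<Sum>k\<in>UNIV. C k $ a $ b * (p b \<times> q a) $ k) / tet_det p)"
    unfolding element_form_def Amat_def B0mat_def B1mat_def B2mat_def VR V C_def[symmetric]
    by (intro sum.cong refl)
      (simp add: sum_3 inner_vec_def[of "dvec p"] add_divide_distrib diff_divide_distrib algebra_simps)
  then show ?thesis
    using Cmat_cross_sum[of p q]
    by (simp add: sum.distrib C_def add_divide_distrib flip: sum_divide_distrib)
qed

lemma radius_ratio_has_derivative:
  fixes P :: "'a::real_normed_vector \<Rightarrow> tet" and P' :: "'a \<Rightarrow> tet"
  assumes P: "\<And>a. ((\<lambda>x. P x a) has_derivative (\<lambda>h. P' h a)) (at x)"
    and pos: "positively_oriented (P x)"
  shows "((\<lambda>x. radius_ratio (P x)) has_derivative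
      (\<lambda>h. radius_ratio (P x) * element_form (P x) (P' h))) (at x)"
\<comment> \<open>The closed formula is known only for positive orientation, so its derivative is
  transferred from a neighbourhood of \<open>x\<close>.\<close>
proof (rule has_derivative_transform_eventually)
  let ?s = "\<lambda>x. surface_area (P x)" and ?n = "\<lambda>x. norm (dvec (P x))" and ?D = "\<lambda>x. tet_det (P x)"
  let ?s' = "\<lambda>h. \<Sum>a\<in>UNIV. \<Sum>b\<in>UNIV. Smat (P x) $ a $ b * (P x b \<bullet> P' h a)"
  let ?d' = "\<lambda>h. (\<Sum>a\<in>UNIV. \<Sum>b\<in>UNIV. Lmat (P x) $ a $ b * (P x b \<bullet> P' h a))
    + (\<Sum>a\<in>UNIV. \<Sum>b\<in>UNIV. Kmat (P x) $ a $ b * (dvec (P x) \<bullet> (P x b \<times> P' h a)))"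
  let ?D' = "\<lambda>h. \<Sum>i\<in>UNIV. inward_normal (P x) i \<bullet> P' h i"
  have D: "?D x > 0" using pos by (simp add: positively_oriented_iff)
  have d: "dvec (P x) \<noteq> 0" using D by (intro dvec_nonzero) simp
  note s = surface_area_pos[OF D]
  have s': "(?s has_derivative ?s') (at x)"
    by (rule surface_area_has_derivative[OF P D])
  have n': "(?n has_derivative (\<lambda>h. ?d' h / ?n x)) (at x)"
    using has_derivative_norm_compose[OF dvec_has_derivative[OF P] d]
    unfolding dvec_inner_derivative .
  have D': "(?D has_derivative ?D') (at x)"
    by (rule tet_det_has_derivative[OF P])
  show "((\<lambda>x. ?s x * ?n x / (3 * (?D x)\<^sup>2)) has_derivative
      (\<lambda>h. radius_ratio (P x) * element_form (P x) (P' h))) (at x)"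
  proof (rule has_derivative_eq_rhs)
    \<comment> \<open>Rewrites the outcome of the quotient rule as the function times its
      logarithmic derivative.\<close>
    have id: "((s * (d / n) + s' * n) * (3 * (D * D)) - s * n * (3 * (D * D' + D' * D)))
        / (3 * (D * D) * (3 * (D * D))) = s * n / (3 * D\<^sup>2) * (s' / s + d / n\<^sup>2 - 2 * D' / D)"
      if "s \<noteq> 0" "n \<noteq> 0" "D \<noteq> 0" for s n D s' d D' :: real
      using that by (simp add: divide_simps power2_eq_square) (simp add: algebra_simps)
    show "((\<lambda>x. ?s x * ?n x / (3 * (?D x)\<^sup>2)) has_derivative (\<lambda>h.
        ((?s x * (?d' h / ?n x) + ?s' h * ?n x) * (3 * (?D x * ?D x))
          - ?s x * ?n x * (3 * (?D x * ?D' h + ?D' h * ?D x)))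
        / (3 * (?D x * ?D x) * (3 * (?D x * ?D x))))) (at x)"
      unfolding power2_eq_square
      by (intro has_derivative_divide' has_derivative_mult has_derivative_mult_right s' n' D')
        (use D in simp)
    show "(\<lambda>h. ((?s x * (?d' h / ?n x) + ?s' h * ?n x) * (3 * (?D x * ?D x))
          - ?s x * ?n x * (3 * (?D x * ?D' h + ?D' h * ?D x)))
        / (3 * (?D x * ?D x) * (3 * (?D x * ?D x))))
      = (\<lambda>h. radius_ratio (P x) * element_form (P x) (P' h))"
      unfolding element_form_eq[OF D] radius_ratio_eq[OF pos]
      by (rule ext, rule id) (use D d s in auto)
  qed
  \<comment> \<open>Positive orientation is an open condition, by continuity of the
    determinant.\<close>
  have "\<forall>\<^sub>F y in at x. ?D y > 0"
    using D has_derivative_continuous[OF D'] by (intro order_tendstoD) (simp_all add: isCont_def)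
  then show "\<forall>\<^sub>F y in at x. ?s y * ?n y / (3 * (?D y)\<^sup>2) = radius_ratio (P y)"
    by eventually_elim (simp add: radius_ratio_eq positively_oriented_iff)
  show "?s x * ?n x / (3 * (?D x)\<^sup>2) = radius_ratio (P x)"
    by (simp add: radius_ratio_eq pos)
qed simp

subsection \<open>Assembly\<close>

lemma sum_UNIV_stack:
  fixes f :: "'v::finite + 'v + 'v \<Rightarrow> real"
  shows "sum f UNIV = (\<Sum>i\<in>UNIV. f (Inl i)) + (\<Sum>i\<in>UNIV. f (Inr (Inl i))) + (\<Sum>i\<in>UNIV. f (Inr (Inr i)))"
  by (simp add: sum.Plus flip: UNIV_Plus_UNIV)

lemma block_matrix_mult_stack:
  "block_matrix M11 M12 M13 M21 M22 M23 M31 M32 M33 *v stack X Y Z =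
    stack (M11 *v X + M12 *v Y + M13 *v Z) (M21 *v X + M22 *v Y + M23 *v Z)
      (M31 *v X + M32 *v Y + M33 *v Z)"
  for X Y Z :: "real^'v::finite"
  by (simp add: vec_eq_iff block_matrix_def stack_def matrix_vector_mult_def sum_UNIV_stack
      split: sum.split)

lemma inner_stack:
  "h \<bullet> stack X Y Z =
    (\<chi> i. h $ Inl i) \<bullet> X + (\<chi> i. h $ Inr (Inl i)) \<bullet> Y + (\<chi> i. h $ Inr (Inr i)) \<bullet> Z"
  for X Y Z :: "real^'v::finite"
  by (simp add: inner_vec_def stack_def sum_UNIV_stack)

text \<open>Paired with vectors, the scattered entries become element forms evaluated at the entries
  gathered through \<open>g\<close>.\<close>

lemma inner_assemble:
  "x \<bullet> (assemble M g V *v y) = 1 / real CARD('c) *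
    (\<Sum>n\<in>UNIV. radius_ratio (cell g V n) *
      (\<Sum>a\<in>UNIV. \<Sum>b\<in>UNIV. M (cell g V n) $ a $ b * (x $ g n a * y $ g n b)))"
  for g :: "'c::finite \<Rightarrow> 4 \<Rightarrow> 'v::finite"
proof -
  define c where "c = 1 / real CARD('c)"
  let ?m = "\<lambda>n a b. radius_ratio (cell g V n) * M (cell g V n) $ a $ b"
  have entry: "assemble M g V $ i $ j =
      c * (\<Sum>n\<in>UNIV. \<Sum>a\<in>UNIV. \<Sum>b\<in>UNIV. if g n a = i \<and> g n b = j then ?m n a b else 0)" for i j
  proof -
    have "(\<Sum>(a, b)\<in>{(a, b). g n a = i \<and> g n b = j}. ?m n a b) =
        (\<Sum>a\<in>UNIV. \<Sum>b\<in>UNIV. if g n a = i \<and> g n b = j then ?m n a b else 0)" for n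
    proof -
      have "(\<Sum>(a, b)\<in>{(a, b). g n a = i \<and> g n b = j}. ?m n a b) =
          (\<Sum>(a, b)\<in>UNIV. if g n a = i \<and> g n b = j then ?m n a b else 0)"
        by (rule sum.mono_neutral_cong_left) (auto split: if_splits)
      then show ?thesis
        by (simp add: sum.cartesian_product)
    qed
    then show ?thesis by (simp add: assemble_def c_def)
  qed
  have pick: "(\<Sum>i\<in>UNIV. \<Sum>j\<in>UNIV. (if k = i \<and> l = j then m else 0) * (x $ i * y $ j)) = m * (x $ k * y $ l)"
    for k l and m :: real
  proof -
    have "(if k = i \<and> l = j then m else 0) * t = (if l = j then if k = i then m * t else 0 else 0)"
      for i j t by simp
    then show ?thesis by simp
  qed
  have "x \<bullet> (assemble M g V *v y) = (\<Sum>i\<in>UNIV. \<Sum>j\<in>UNIV. assemble M g V $ i $ j * (x $ i * y $ j))"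
    by (simp add: inner_vec_def matrix_vector_mult_def sum_distrib_left mult_ac)
  also have "\<dots> = c * (\<Sum>i\<in>UNIV. \<Sum>j\<in>UNIV. \<Sum>n\<in>UNIV. \<Sum>a\<in>UNIV. \<Sum>b\<in>UNIV.
      (if g n a = i \<and> g n b = j then ?m n a b else 0) * (x $ i * y $ j))"
    by (simp only: entry sum_distrib_left sum_distrib_right mult.assoc)
  also have "\<dots> = c * (\<Sum>n\<in>UNIV. \<Sum>a\<in>UNIV. \<Sum>b\<in>UNIV. \<Sum>i\<in>UNIV. \<Sum>j\<in>UNIV.
      (if g n a = i \<and> g n b = j then ?m n a b else 0) * (x $ i * y $ j))"
    \<comment> \<open>The fixed index types orient the exchange: vertex sums only move inward, so
      rewriting terminates.\<close>
    by (simp only: sum.swap[where A = "UNIV :: 'v set" and B = "UNIV :: 'c set"]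
        sum.swap[where A = "UNIV :: 'v set" and B = "UNIV :: 4 set"])
  also have "\<dots> = c * (\<Sum>n\<in>UNIV. \<Sum>a\<in>UNIV. \<Sum>b\<in>UNIV. ?m n a b * (x $ g n a * y $ g n b))"
    unfolding pick ..
  finally show ?thesis
    by (simp add: c_def sum_distrib_left mult.assoc)
qed

text \<open>Exchanging the two local indices; symmetry and antisymmetry thus pass from elements to
  the mesh.\<close>

lemma transpose_assemble:
  "transpose (assemble M g V) = assemble (\<lambda>p. transpose (M p)) g V"
proof -
  have "(\<Sum>(a, b)\<in>{(a, b). g n a = j \<and> g n b = i}. radius_ratio (cell g V n) * M (cell g V n) $ a $ b)
      = (\<Sum>(a, b)\<in>{(a, b). g n a = i \<and> g n b = j}. radius_ratio (cell g V n) * M (cell g V n) $ b $ a)"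
    for i j n
    by (rule sum.reindex_bij_witness[of _ prod.swap prod.swap]) auto
  then show ?thesis
    by (simp add: vec_eq_iff transpose_def assemble_def)
qed

lemma assemble_minus: "assemble (\<lambda>p. - M p) g V = - assemble M g V"
  by (simp add: vec_eq_iff assemble_def case_prod_beta sum_negf)

section \<open>Symmetry and antisymmetry of the element matrices\<close>

lemma transpose_vec4:
  "transpose (vec4 (vec4 a00 a01 a02 a03) (vec4 a10 a11 a12 a13) (vec4 a20 a21 a22 a23) (vec4 a30 a31 a32 a33))
    = vec4 (vec4 a00 a10 a20 a30) (vec4 a01 a11 a21 a31) (vec4 a02 a12 a22 a32) (vec4 a03 a13 a23 a33)"
  unfolding vec_eq_iff forall_4_0 by (simp add: transpose_def)

lemma uminus_vec4: "- vec4 a b c d = vec4 (- a) (- b) (- c) (- d)"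
  unfolding vec_eq_iff forall_4_0 by simp

lemma transpose_add: "transpose (M + N) = transpose M + transpose N"
  and transpose_diff: "transpose (M - N) = transpose M - transpose N"
  and transpose_uminus: "transpose (- M) = - transpose M"
  and transpose_scaleR: "transpose (c *\<^sub>R M) = c *\<^sub>R transpose M"
  for M N :: "real^'n^'m"
  by (simp_all add: vec_eq_iff transpose_def)

lemma transpose_Lmat: "transpose (Lmat p) = Lmat p"
  unfolding Lmat_def Let_def transpose_vec4 ..

lemma transpose_Smat: "transpose (Smat p) = Smat p"
  unfolding Smat_def Let_def transpose_vec4 ..

lemma transpose_Kmat: "transpose (Kmat p) = - Kmat p"
  unfolding Kmat_def Let_def transpose_vec4 uminus_vec4 by simp

lemma transpose_Amat: "transpose (Amat p) = Amat p"
  by (simp add: Amat_def transpose_add transpose_scaleR transpose_Lmat transpose_Smat)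

lemma transpose_Bmat:
  "transpose (B0mat p) = - B0mat p" "transpose (B1mat p) = - B1mat p" "transpose (B2mat p) = - B2mat p"
  by (simp_all add: B0mat_def B1mat_def B2mat_def transpose_add transpose_diff transpose_uminus
      transpose_scaleR      transpose_Kmat scaleR_diff_right)

section \<open>The gradient of the mesh energy\<close>

lemma cell_nth:
  "cell g V n a $ 1 = V $ Inl (g n a)" "cell g V n a $ 2 = V $ Inr (Inl (g n a))"
  "cell g V n a $ 3 = V $ Inr (Inr (g n a))"
  by (simp_all add: cell_def mesh_vertex_def)

text \<open>A cell vertex is linear in the coordinate vector, so it is its own derivative.\<close>

lemma cell_has_derivative: "((\<lambda>V. cell g V n a) has_derivative (\<lambda>h. cell g h n a)) F"
proof (rule bounded_linear_imp_has_derivative, rule linear_conv_bounded_linear[THEN iffD1])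
  show "linear (\<lambda>V. cell g V n a)"
    by (rule linearI) (simp_all add: vec_eq_iff forall_3 cell_nth)
qed

text \<open>Splits the cross products again: the nine sums match the nine blocks of the gradient
  matrix, row by row.\<close>

lemma element_form_components:
  "element_form p q =
     (\<Sum>a\<in>UNIV. \<Sum>b\<in>UNIV. Amat p $ a $ b * (q a $ 1 * p b $ 1))
   + (\<Sum>a\<in>UNIV. \<Sum>b\<in>UNIV. B2mat p $ a $ b * (q a $ 1 * p b $ 2))
   + (\<Sum>a\<in>UNIV. \<Sum>b\<in>UNIV. B1mat p $ a $ b * (q a $ 1 * p b $ 3))
   - (\<Sum>a\<in>UNIV. \<Sum>b\<in>UNIV. B2mat p $ a $ b * (q a $ 2 * p b $ 1))
   + (\<Sum>a\<in>UNIV. \<Sum>b\<in>UNIV. Amat p $ a $ b * (q a $ 2 * p b $ 2))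
   + (\<Sum>a\<in>UNIV. \<Sum>b\<in>UNIV. B0mat p $ a $ b * (q a $ 2 * p b $ 3))
   - (\<Sum>a\<in>UNIV. \<Sum>b\<in>UNIV. B1mat p $ a $ b * (q a $ 3 * p b $ 1))
   - (\<Sum>a\<in>UNIV. \<Sum>b\<in>UNIV. B0mat p $ a $ b * (q a $ 3 * p b $ 2))
   + (\<Sum>a\<in>UNIV. \<Sum>b\<in>UNIV. Amat p $ a $ b * (q a $ 3 * p b $ 3))"
  unfolding element_form_def sum.distrib[symmetric] sum_subtractf[symmetric]
  by (intro sum.cong refl) (simp add: inner_vec_def sum_3 cross_components algebra_simps)

theorem theorem2p3:
  fixes g :: "'c::finite \<Rightarrow> 4 \<Rightarrow> 'v::finite"
    and X Y Z :: "real^'v"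
  assumes "\<And>n. positively_oriented (cell g (stack X Y Z) n)"
  shows "let V = stack X Y Z;
             A = assemble Amat g V;
             B0 = assemble B0mat g V;
             B1 = assemble B1mat g V;
             B2 = assemble B2mat g V;
             G = block_matrix
                      A     B2    B1
                   (- B2)   A     B0
                   (- B1) (- B0)  A
         in GDERIV (mesh_energy g) V :> G *v V
          \<and> transpose A = A
          \<and> transpose B0 = - B0
          \<and> transpose B1 = - B1
          \<and> transpose B2 = - B2"
proof -
  define V where "V = stack X Y Z"
  define A where "A = assemble Amat g V"
  define B0 where "B0 = assemble B0mat g V"
  define B1 where "B1 = assemble B1mat g V"
  define B2 where "B2 = assemble B2mat g V"
  define G where "G = block_matrix A B2 B1 (- B2) A B0 (- B1) (- B0) A"
  have coord: "V $ Inl i = X $ i" "V $ Inr (Inl i) = Y $ i" "V $ Inr (Inr i) = Z $ i" for i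
    by (simp_all add: V_def stack_def)
  have form: "1 / real CARD('c) *
      (\<Sum>n\<in>UNIV. radius_ratio (cell g V n) * element_form (cell g V n) (cell g h n)) = h \<bullet> (G *v V)" for h
  proof -
    have neg: "(- M) *v y = - (M *v y)" for M :: "real^'v^'v" and y
      by (simp add: vec_eq_iff matrix_vector_mult_def sum_negf)
    show ?thesis
      unfolding G_def
      \<comment> \<open>\<open>V\<close> is opened as a stack only to multiply the blocks, then
        folded back so that both sides refer to the same cells.\<close>
      unfolding V_def block_matrix_mult_stack inner_stack
      unfolding V_def[symmetric] neg inner_add_right inner_minus_right
        A_def B0_def B1_def B2_def inner_assemble element_form_components cell_nth coord
        distrib_left right_diff_distrib sum.distrib sum_subtractf vec_lambda_beta
      by linarith
  qed
  have "(mesh_energy g has_derivative (\<lambda>h. 1 / real CARD('c) *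
      (\<Sum>n\<in>UNIV. radius_ratio (cell g V n) * element_form (cell g V n) (cell g h n)))) (at V)"
    unfolding mesh_energy_def[abs_def]
    by (intro has_derivative_mult_right has_derivative_sum radius_ratio_has_derivative cell_has_derivative)
      (use assms in \<open>simp add: V_def\<close>)
  then have "GDERIV (mesh_energy g) V :> G *v V"
    unfolding gderiv_def form .
  moreover have "transpose A = A" "transpose B0 = - B0" "transpose B1 = - B1" "transpose B2 = - B2"
    unfolding A_def B0_def B1_def B2_def transpose_assemble transpose_Amat transpose_Bmat assemble_minus
    by (rule refl)+
  ultimately show ?thesis
    unfolding Let_def by (simp add: V_def A_def B0_def B1_def B2_def G_def)
qed

end
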